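(* There is exactly one unordered pair of non-congruent amicable Heron triangles, up to congruence: the triangle with side lengths $(3,25,26)$ and the triangle with side lengths $(9,12,15)$. That is, these two triangles are amicable Heron triangles, and if $H_1$ and $H_2$ are non-congruent Heron triangles that are amicable, then one of them has side lengths $3,25,26$ and the other has side lengths $9,12,15$.
   Context: A Heron triangle is a (non-degenerate) triangle whose side lengths and area are integers. Two Heron triangles $H_1$ and $H_2$ are called amicable if the area of $H_1$ equals the perimeter of $H_2$ and the perimeter of $H_1$ equals the area of $H_2$. Triangles are considered up to congruence, i.e. they are identified with their multisets of side lengths. *)

theory Defs
  imports "HOL-Analysis.Analysis" "HOL-Library.Multiset"
begin

text \<open>A triangle is given by its three vertices in the Euclidean plane.\<close>

type_synonym triangle = "(real ^ 2) \<times> (real ^ 2) \<times> (real ^ 2)"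

fun nondegenerate :: "triangle \<Rightarrow> bool" where
  "nondegenerate (A, B, C) \<longleftrightarrow> \<not> collinear {A, B, C}"

fun side_lengths :: "triangle \<Rightarrow> real multiset" where
  "side_lengths (A, B, C) = {#dist B C, dist A C, dist A B#}"

definition perimeter :: "triangle \<Rightarrow> real" where
  "perimeter T = sum_mset (side_lengths T)"

fun area :: "triangle \<Rightarrow> real" where
  "area (A, B, C) = measure lborel (convex hull {A, B, C})"

text \<open>Congruence is identified with having the same multiset of side lengths (SSS).\<close>

definition congruent_triangles :: "triangle \<Rightarrow> triangle \<Rightarrow> bool" where
  "congruent_triangles S T \<longleftrightarrow> side_lengths S = side_lengths T"

definition heron_triangle :: "triangle \<Rightarrow> bool" where
  "heron_triangle T \<longleftrightarrow>
     nondegenerate T \<and> (\<forall>l \<in># side_lengths T. l \<in> \<int>) \<and> area T \<in> \<int>"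

definition amicable :: "triangle \<Rightarrow> triangle \<Rightarrow> bool" where
  "amicable S T \<longleftrightarrow> area S = perimeter T \<and> perimeter S = area T"

end

theory Submission
  imports Defs
begin

text \<open>Let \<open>s\<close> be the semiperimeter of a Heron triangle with sides \<open>a \<le> b \<le> c\<close>. Its tangent lengths
  \<open>x = s - a\<close>, \<open>y = s - b\<close>, \<open>z = s - c\<close> are positive integers, and Heron's formula reads
  \<open>area\<^sup>2 = s * x * y * z\<close> with \<open>s = x + y + z\<close> (\<open>heron_triangle_tangents\<close>). If \<open>t = u + v + w\<close> belongs
  in the same way to the other triangle, then the two triangles are amicable iff
  \<open>s * x * y * z = 4 * t\<^sup>2\<close> and \<open>t * u * v * w = 4 * s\<^sup>2\<close>. By symmetry assume \<open>t \<le> s\<close>.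

  The first equation gives \<open>x * y * z \<le> 4 * s \<le> 12 * x\<close>, so \<open>y * z \<le> 12\<close>; and if \<open>y * z \<ge> 5\<close>,
  then \<open>x \<le> 24\<close> (\<open>x_le\<close>). If \<open>y * z \<le> 4\<close>, then \<open>x\<close> is not bounded by this inequality. For
  \<open>(y, z)\<close> among \<open>(1, 1)\<close>, \<open>(2, 2)\<close>, \<open>(4, 1)\<close> the first equation asks for a square between two
  nearby squares, but for \<open>(2, 1)\<close> and \<open>(3, 1)\<close> it is a Pell equation with infinitely many
  solutions. There the second equation helps: it makes \<open>4 * s\<^sup>2\<close> a multiple of \<open>t\<close>, and the two
  equations together imply that \<open>x\<close> divides \<open>64 * (y + z)\<^sup>3\<close> (\<open>x_dvd\<close>). So only finitely many
  \<open>(x, y, z)\<close> remain;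
  those for which \<open>s * x * y * z / 4\<close> is a square are listed in \<open>candidates\<close>. Each of them
  determines \<open>t\<close> and \<open>u * v * w = 4 * s\<^sup>2 / t\<close>, and a second finite search for \<open>u, v, w\<close> leaves
  \<open>(24, 2, 1)\<close> with \<open>(9, 6, 3)\<close>, which are the triangles \<open>(3, 25, 26)\<close> and \<open>(9, 12, 15)\<close>, and
  five triangles that are only amicable to themselves (\<open>solutions\<close>).\<close>

section \<open>Tangent lengths of Heron triangles\<close>

lemma side_lengths_lt_half_perimeter:
  assumes "nondegenerate T" "l \<in># side_lengths T"
  shows "2 * l < perimeter T"
proof -
  obtain A B C where T: "T = (A, B, C)" by (cases T)
  have nc: "\<not> collinear {A, B, C}" using assms(1) by (simp add: T)
  have "\<not> between (A, B) C" "\<not> between (A, C) B" "\<not> between (B, C) A"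
    using nc by (auto dest!: between_imp_collinear simp: insert_commute)
  then have "dist A B < dist A C + dist B C" "dist A C < dist A B + dist B C"
    "dist B C < dist A B + dist A C"
    using dist_triangle[of A B C] dist_triangle[of A C B] dist_triangle[of B C A]
    by (auto simp: between dist_commute)
  then show ?thesis
    using assms(2) by (auto simp: T perimeter_def)
qed

lemma area_nonneg: "area T \<ge> 0"
  by (cases T) simp

text \<open>Written over the multiset of side lengths, Heron's formula does not depend on the order
  of the vertices.\<close>

lemma heron_mset:
  "16 * (area T)\<^sup>2 = perimeter T * (\<Prod>l\<in>#side_lengths T. perimeter T - 2 * l)"
proof -
  obtain A B C where T: "T = (A, B, C)" by (cases T)
  define a b c where abc: "a = dist B C" "b = dist A C" "c = dist A B"
  define s where "s = (a + b + c) / 2"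
  have ineq: "0 \<le> s" "0 \<le> s - a" "0 \<le> s - b" "0 \<le> s - c"
    using dist_triangle[of A B C] dist_triangle[of A C B] dist_triangle[of B C A]
    by (auto simp: s_def abc dist_commute)
  have "area T = sqrt (s * (s - a) * (s - b) * (s - c))"
    by (simp add: T heron abc s_def)
  then have "(area T)\<^sup>2 = s * (s - a) * (s - b) * (s - c)"
    using ineq by simp
  also have "16 * \<dots> = (2 * s) * ((2 * s - 2 * a) * ((2 * s - 2 * b) * (2 * s - 2 * c)))"
    by (simp add: algebra_simps)
  also have "2 * s = perimeter T"
    by (simp add: s_def T perimeter_def abc)
  finally show ?thesis
    by (simp add: T abc mult.assoc)
qed

lemma heron_sides:
  assumes "side_lengths T = {#a, b, c#}"
  shows "16 * (area T)\<^sup>2 = (a + b + c) * ((b + c - a) * ((a + c - b) * (a + b - c)))"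
  using heron_mset[of T] assms by (simp add: perimeter_def algebra_simps)

lemma side_lengths_sorted:
  obtains a b c where "a \<le> b" "b \<le> c" "side_lengths T = {#a, b, c#}"
proof -
  obtain a b c where abc: "side_lengths T = {#a, b, c#}"
    by (cases T) auto
  have "\<exists>a b c. a \<le> b \<and> b \<le> c \<and> side_lengths T = {#a, b, c#}"
  proof -
    consider "a \<le> b" "b \<le> c" | "a \<le> c" "c \<le> b" | "b \<le> a" "a \<le> c" | "b \<le> c" "c \<le> a"
      | "c \<le> a" "a \<le> b" | "c \<le> b" "b \<le> a" by linarith
    then show ?thesis unfolding abc by cases (metis add_mset_commute)+
  qed
  then show ?thesis using that by blast
qed

text \<open>Here \<open>a \<le> b \<le> c\<close> are the sides, and the parameters are the tangent lengths \<open>x = s - a\<close>, \<open>y = s - b\<close>, \<open>z = s - c\<close>, where \<open>s\<close> is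
  the semiperimeter. They are integers because the perimeter of a Heron triangle is even:
  otherwise the four factors in Heron's formula are odd, while \<open>16 * area\<^sup>2\<close> is even. Ordering the
  sides makes \<open>z\<close> the least parameter, so \<open>z > 0\<close> is the only strict triangle inequality needed.\<close>

lemma heron_triangle_tangents:
  assumes "heron_triangle T"
  obtains x y z :: int where "0 < z" "z \<le> y" "y \<le> x"
    "side_lengths T = {#of_int (y + z), of_int (x + z), of_int (x + y)#}"
    "perimeter T = of_int (2 * (x + y + z))"
    "(area T)\<^sup>2 = of_int ((x + y + z) * x * y * z)"
proof -
  obtain a' b' c' where ord: "a' \<le> b'" "b' \<le> c'" and sl': "side_lengths T = {#a', b', c'#}"
    by (rule side_lengths_sorted)
  have "a' \<in> \<int>" "b' \<in> \<int>" "c' \<in> \<int>" "area T \<in> \<int>" and nd: "nondegenerate T"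
    using assms sl' by (auto simp: heron_triangle_def)
  then obtain a b c k :: int
    where abc: "a' = of_int a" "b' = of_int b" "c' = of_int c" and k: "area T = of_int k"
    by (auto elim!: Ints_cases)
  have sl: "side_lengths T = {#of_int a, of_int b, of_int c#}" using sl' abc by simp
  have "(of_int (16 * k\<^sup>2) :: real) =
      of_int ((a + b + c) * ((b + c - a) * ((a + c - b) * (a + b - c))))"
    using heron_sides[OF sl] k by simp
  then have her: "16 * k\<^sup>2 = (a + b + c) * ((b + c - a) * ((a + c - b) * (a + b - c)))"
    by (simp only: of_int_eq_iff)
  have "even ((a + b + c) * ((b + c - a) * ((a + c - b) * (a + b - c))))"
    unfolding her[symmetric] by simp
  then have ev: "even (a + b + c)" by auto
  define x y z where xyz: "x = (b + c - a) div 2" "y = (a + c - b) div 2" "z = (a + b - c) div 2"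
  have xyz2: "b + c - a = 2 * x" "a + c - b = 2 * y" "a + b - c = 2 * z"
    using ev unfolding xyz by presburger+
  then have sides: "a = y + z" "b = x + z" "c = x + y" by linarith+
  have "2 * real_of_int c < perimeter T"
    using side_lengths_lt_half_perimeter[OF nd] sl by auto
  then have "z > 0"
    using sl by (simp add: perimeter_def sides)
  moreover have "z \<le> y" "y \<le> x"
    using ord abc sides by auto
  moreover have "16 * k\<^sup>2 = 16 * ((x + y + z) * x * y * z)"
    unfolding her xyz2 unfolding sides by (simp add: algebra_simps)
  then have "k\<^sup>2 = (x + y + z) * x * y * z" by linarith
  then have "(area T)\<^sup>2 = of_int ((x + y + z) * x * y * z)"
    unfolding k by (metis of_int_power)
  moreover have "perimeter T = of_int (2 * (x + y + z))"
    using sl by (simp add: perimeter_def sides)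
  ultimately show ?thesis
    using that sl sides by blast
qed

section \<open>The Diophantine system\<close>

text \<open>The system that the tangent lengths of two amicable Heron triangles satisfy. The area of the
  first triangle is \<open>2 * t\<close> and that of the second is \<open>2 * s\<close>, which gives \<open>area1\<close> and \<open>area2\<close>. The
  assumption \<open>le\<close> only fixes which triangle is called the first.\<close>

locale amicable_tangents =
  fixes x y z s u v w t :: int
  assumes ord: "0 < z" "z \<le> y" "y \<le> x" "0 < w" "w \<le> v" "v \<le> u"
    and s: "s = x + y + z" and t: "t = u + v + w"
    and area1: "s * (x * y * z) = 4 * t\<^sup>2" and area2: "t * (u * v * w) = 4 * s\<^sup>2"
    and le: "t \<le> s"
begin

lemma pos: "0 < x" "0 < y" "0 < s" "0 < t"
  using ord s t by auto

lemma prod_le: "x * (y * z) \<le> 4 * s"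
proof -
  have "s * (x * (y * z)) \<le> s * (4 * s)"
    using area1 mult_mono[OF le le] pos by (simp add: power2_eq_square mult.assoc)
  then show ?thesis using pos by simp
qed

lemma yz_le: "y * z \<le> 12"
proof -
  have "x * (y * z) \<le> x * 12" using prod_le ord s by linarith
  then show ?thesis using pos by simp
qed

lemma z_le: "z \<le> 3"
proof (rule ccontr)
  assume "\<not> z \<le> 3"
  then have "4 * 4 \<le> y * z" using ord by (intro mult_mono) auto
  then show False using yz_le by simp
qed

lemma y_le: "y \<le> 12"
proof -
  have "y * 1 \<le> y * z" using ord by (intro mult_left_mono) auto
  then show ?thesis using yz_le by simp
qed

lemma x_le:
  assumes "5 \<le> y * z"
  shows "x \<le> 24"
proof (rule ccontr)
  assume "\<not> x \<le> 24"
  \<comment> \<open>\<open>x * (y * z) \<le> 4 * s\<close> means \<open>(x - 4) * (y * z - 4) \<le> 4 * (y + z) + 16 - 4 * y * z\<close>,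
      and the right-hand side is at most \<open>20\<close>.\<close>
  then have "(x - 4) * (y * z - 4) \<ge> 21 * (y * z - 4)"
    using assms by (intro mult_right_mono) auto
  moreover have "0 \<le> (y - 1) * (z - 1)" using ord by simp
  ultimately show False
    using prod_le s assms by (simp add: algebra_simps)
qed

text \<open>Multiplying the first equation by \<open>(u * v * w)\<^sup>2\<close> and inserting the second shows that \<open>x\<close>
  divides \<open>64 * s ^ 3\<close>, and \<open>s\<close> is congruent to \<open>y + z\<close> modulo \<open>x\<close>.\<close>

lemma x_dvd: "x dvd 64 * (y + z) ^ 3"
proof -
  have "s * (x * (y * z * (u * v * w)\<^sup>2)) = (s * (x * y * z)) * (u * v * w)\<^sup>2" by algebra
  also have "\<dots> = 4 * (t * (u * v * w))\<^sup>2" unfolding area1 by algebra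
  also have "\<dots> = s * (64 * s ^ 3)" unfolding area2 by algebra
  finally have "x * (y * z * (u * v * w)\<^sup>2) = 64 * s ^ 3" using pos by simp
  then have "x dvd 64 * s ^ 3" by (metis dvd_triv_left)
  moreover have "64 * s ^ 3 = 64 * (y + z) ^ 3 + x * (64 * (x\<^sup>2 + 3 * x * (y + z) + 3 * (y + z)\<^sup>2))"
    unfolding s by algebra
  ultimately show ?thesis
    by (metis dvd_add_left_iff dvd_triv_left)
qed

end

section \<open>Finite searches\<close>

text \<open>The searches below are written with \<open>list_all\<close> and with conditionals in place of implications:
  the simplifier then unfolds an inner list only if the condition in front of it has been
  evaluated to \<open>True\<close>.\<close>

lemma upto_0_numeral:
  assumes "numeral n \<ge> (2::int)"
  shows "[0..numeral n] = 0 # 1 # [2..numeral n :: int]"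
  using assms by (simp add: upto_rec1)

lemma upto_1_numeral: "[1..numeral n] = 1 # [2..numeral n :: int]"
  by (simp add: upto_rec1)

lemma base_between:
  fixes a b t :: int
  assumes "a\<^sup>2 < t\<^sup>2" "t\<^sup>2 < b\<^sup>2" "0 < t" "0 < b"
  shows "a < t" "t < b"
  using assms power2_less_imp_less[of a t] power2_less_imp_less[of t b] by simp_all

lemma if_else_True: "(if P then Q else True) \<longleftrightarrow> (P \<longrightarrow> Q)"
  by simp

text \<open>The case \<open>y * z \<ge> 5\<close>. The solution \<open>(3, 3, 2, 6)\<close> has no partner triangle.\<close>

lemma square_search_bounded:
  "list_all (\<lambda>z::int. list_all (\<lambda>y. if 5 \<le> y * z \<and> y * z \<le> 12 then list_all (\<lambda>x.
     if x * (y * z) \<le> 4 * (x + y + z) then list_all (\<lambda>t.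
       if (x + y + z) * (x * y * z) = 4 * (t * t) then
         (x, y, z, t) \<in> {(24, 5, 1, 30), (14, 6, 1, 21), (9, 8, 1, 18), (10, 3, 2, 15),
           (6, 4, 2, 12), (3, 3, 2, 6)}
       else True) [1..x + y + z] else True) [y..24] else True) [z..12]) [1..3]"
  by (simp add: upto_1_numeral)

text \<open>The case \<open>(y, z) = (2, 1)\<close>, where \<open>64 * (y + z) ^ 3 = 1728\<close>. The range of \<open>t\<close> comes from
  \<open>2 * t\<^sup>2 = x * (x + 3)\<close>, which puts \<open>t\<close> slightly above \<open>x / sqrt 2 > 7 * x / 10\<close>.\<close>

lemma square_search_2_1:
  "list_all (\<lambda>x::int. if x dvd 1728 then list_all (\<lambda>t.
     if x * (x + 3) = 2 * (t * t) then (x, t) \<in> {(1, 1), (3, 3), (24, 18), (864, 612)}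
     else True) [7 * x div 10..x + 1] else True) [1..1728]"
  by (simp add: upto_1_numeral upto_0_numeral)

text \<open>The case \<open>(y, z) = (3, 1)\<close>, where \<open>64 * (y + z) ^ 3 = 4096 = 2 ^ 12\<close>, so that \<open>x\<close> is a power
  of \<open>2\<close>; here \<open>t\<close> lies slightly above \<open>x * sqrt 3 / 2 > 86 * x / 100\<close>.\<close>

lemma square_search_3_1:
  "list_all (\<lambda>x::int. list_all (\<lambda>t.
     if 3 * (x * (x + 4)) = 4 * (t * t) then (x, t) = (2, 3) else True) [86 * x div 100..x + 1])
     [1, 2, 4, 8, 16, 32, 64, 128, 256, 512, 1024, 2048, 4096]"
  by (simp add: upto_1_numeral upto_0_numeral)

text \<open>The search for the second triangle. The bounds on \<open>w\<close> and \<open>v\<close> are \<open>t div 3\<close> and \<open>t div 2\<close>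
  for the largest value \<open>t = 30\<close>.\<close>

lemma partner_search:
  "list_all (\<lambda>(s, t). list_all (\<lambda>w. if 3 * w \<le> t then list_all (\<lambda>v.
     if 2 * v + w \<le> t then
       if t * ((t - v - w) * v * w) = 4 * (s * s) then
         (s, t - v - w, v, w) \<in> {(27, 9, 6, 3), (30, 24, 5, 1), (21, 14, 6, 1), (18, 9, 8, 1),
           (15, 10, 3, 2), (12, 6, 4, 2)}
       else True else True) [w..15] else True) [1..10])
     [(6::int, 3::int), (27, 18), (9, 6), (8, 6), (30, 30), (21, 21), (18, 18), (15, 15), (12, 12)]"
  by (simp add: upto_1_numeral)

text \<open>The candidate \<open>(864, 2, 1)\<close> has \<open>s = 867\<close> and \<open>t = 612\<close>, hence \<open>u * v * w = 4913 = 17 ^ 3\<close>; this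
  bounds \<open>w\<close> by \<open>17\<close> and \<open>v\<close> by \<open>70\<close>.\<close>

lemma partner_search_612:
  "list_all (\<lambda>w::int. list_all (\<lambda>v. (612 - v - w) * v * w \<noteq> 4913) [w..70]) [1..17]"
  by (simp add: upto_1_numeral)

section \<open>Solution of the system\<close>

context amicable_tangents
begin

lemma candidates:
  "(x, y, z, t) \<in> {(3, 2, 1, 3), (24, 2, 1, 18), (864, 2, 1, 612), (2, 3, 1, 3), (4, 4, 1, 6),
     (3, 3, 2, 6), (24, 5, 1, 30), (14, 6, 1, 21), (9, 8, 1, 18), (10, 3, 2, 15), (6, 4, 2, 12)}"
proof (cases "5 \<le> y * z")
  case True
  have range: "z \<in> {1..3}" "y \<in> {z..12}" "x \<in> {y..24}" "t \<in> {1..x + y + z}"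
    using ord z_le y_le x_le[OF True] le pos s by auto
  have eq: "(x + y + z) * (x * y * z) = 4 * (t * t)" and bd: "x * (y * z) \<le> 4 * (x + y + z)"
    using area1 prod_le by (simp_all add: s power2_eq_square)
  have "(x, y, z, t) \<in> {(24, 5, 1, 30), (14, 6, 1, 21), (9, 8, 1, 18),
      (10, 3, 2, 15), (6, 4, 2, 12), (3, 3, 2, 6)}"
    using square_search_bounded[unfolded list_all_iff set_upto if_else_True, rule_format,
        OF range(1,2) conjI[OF True yz_le] range(3) bd range(4) eq] .
  then show ?thesis by (elim insertE; simp)
next
  case False
  then have yz4: "y * z \<le> 4" by simp
  have "z < 3"
  proof (rule ccontr)
    assume "\<not> z < 3"
    then have "3 * 3 \<le> y * z" using ord by (intro mult_mono) auto
    then show False using yz4 by simp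
  qed
  then have "z = 1 \<or> z = 2" using ord by auto
  then consider "y = 1" "z = 1" | "y = 2" "z = 1" | "y = 3" "z = 1" | "y = 4" "z = 1"
    | "y = 2" "z = 2"
    using ord yz4 by fastforce
  then show ?thesis
  proof cases
    case 1
    \<comment> \<open>In this case and in the last one a square would lie between two consecutive squares.\<close>
    have "(2 * t)\<^sup>2 = x * (x + 2)"
      using area1 by (simp add: s 1 power2_eq_square algebra_simps)
    then have "x\<^sup>2 < (2 * t)\<^sup>2" "(2 * t)\<^sup>2 < (x + 1)\<^sup>2"
      using pos by (simp_all add: power2_eq_square algebra_simps)
    then have "x < 2 * t" "2 * t < x + 1"
      using base_between pos by (smt (verit))+
    then show ?thesis by linarith
  next
    case 2
    have eq: "x * (x + 3) = 2 * (t * t)"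
      using area1 by (simp add: s 2 power2_eq_square algebra_simps)
    then have eq2: "x * x + 3 * x = 2 * (t * t)" by (simp add: algebra_simps)
    have "t < x + 2"
    proof (rule ccontr)
      assume "\<not> t < x + 2"
      then have "(x + 2) * (x + 2) \<le> t * t" using pos by (intro mult_mono) auto
      then have "x * x + 4 * x + 4 \<le> t * t"
        by (simp add: algebra_simps)
      then show False using eq2 zero_le_square[of x] pos by linarith
    qed
    moreover have "7 * x \<le> 10 * t"
    proof (rule ccontr)
      assume "\<not> 7 * x \<le> 10 * t"
      then have le: "10 * t \<le> 7 * x" by simp
      have "100 * (t * t) \<le> 49 * (x * x)"
        using mult_mono[OF le le] pos by (simp add: algebra_simps)
      then show False using eq2 zero_le_square[of x] pos by linarith
    qed
    ultimately have "t \<in> {7 * x div 10..x + 1}" by auto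
    moreover have "x dvd 1728" using x_dvd by (simp add: 2)
    then have "x \<in> {1..1728}" "x dvd 1728"
      using pos by (auto dest: zdvd_imp_le)
    ultimately have "(x, t) \<in> {(1, 1), (3, 3), (24, 18), (864, 612)}"
      using eq by (intro square_search_2_1[unfolded list_all_iff set_upto if_else_True, rule_format])
    then show ?thesis using ord by (auto simp: 2)
  next
    case 3
    have eq: "3 * (x * (x + 4)) = 4 * (t * t)"
      using area1 by (simp add: s 3 power2_eq_square algebra_simps)
    then have eq2: "3 * (x * x) + 12 * x = 4 * (t * t)" by (simp add: algebra_simps)
    have "t < x + 2"
    proof (rule ccontr)
      assume "\<not> t < x + 2"
      then have "(x + 2) * (x + 2) \<le> t * t" using pos by (intro mult_mono) auto
      then have "x * x + 4 * x + 4 \<le> t * t"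
        by (simp add: algebra_simps)
      then show False using eq2 zero_le_square[of x] pos by linarith
    qed
    moreover have "86 * x \<le> 100 * t"
    proof (rule ccontr)
      assume "\<not> 86 * x \<le> 100 * t"
      then have le: "100 * t \<le> 86 * x" by simp
      have "10000 * (t * t) \<le> 7396 * (x * x)"
        using mult_mono[OF le le] pos by (simp add: algebra_simps)
      then show False using eq2 zero_le_square[of x] pos by linarith
    qed
    ultimately have "t \<in> {86 * x div 100..x + 1}" by auto
    moreover have "x dvd 2 ^ 12" using x_dvd by (simp add: 3)
    then obtain m where "m \<le> 12" "normalize x = 2 ^ m"
      using divides_primepow[of 2 x 12] by auto
    then have "x \<in> set [1, 2, 4, 8, 16, 32, 64, 128, 256, 512, 1024, 2048, 4096]"
      using pos by (auto simp: le_Suc_eq numeral_eq_Suc)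
    ultimately have "(x, t) = (2, 3)"
      using eq by (intro square_search_3_1[unfolded list_all_iff set_upto if_else_True, rule_format])
    then show ?thesis by (auto simp: 3)
  next
    case 4
    have eq: "x * (x + 5) = t\<^sup>2"
      using area1 by (simp add: s 4 algebra_simps)
    then have "(x + 1)\<^sup>2 < t\<^sup>2" "t\<^sup>2 < (x + 3)\<^sup>2"
      using pos ord 4 by (simp_all add: power2_eq_square algebra_simps)
    then have "x + 1 < t" "t < x + 3"
      using base_between pos by (smt (verit))+
    then have "t = x + 2" by simp
    then have "x = 4" using eq by (simp add: power2_eq_square algebra_simps)
    then show ?thesis using \<open>t = x + 2\<close> 4 by simp
  next
    case 5
    have "t\<^sup>2 = x * (x + 4)"
      using area1 by (simp add: s 5 algebra_simps)
    then have "(x + 1)\<^sup>2 < t\<^sup>2" "t\<^sup>2 < (x + 2)\<^sup>2"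
      using pos ord 5 by (simp_all add: power2_eq_square algebra_simps)
    then have "x + 1 < t" "t < x + 2"
      using base_between pos by (smt (verit))+
    then show ?thesis by linarith
  qed
qed

text \<open>In the second alternative the two triangles are congruent, with area equal to perimeter.\<close>

theorem solutions:
  "(x, y, z) = (24, 2, 1) \<and> (u, v, w) = (9, 6, 3) \<or> (x, y, z) = (u, v, w)"
proof -
  have u: "u = t - v - w" using t by simp
  have eq: "t * ((t - v - w) * v * w) = 4 * (s * s)"
    using area2 unfolding u by (simp add: power2_eq_square)
  have le3: "3 * w \<le> t" "2 * v + w \<le> t" using ord t by auto
  have "(s, t) \<in> {(867, 612), (6, 3), (27, 18), (9, 6), (8, 6), (30, 30), (21, 21), (18, 18),
      (15, 15), (12, 12)}"
    using candidates by (elim insertE; simp add: s)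
  then consider "(s, t) = (867, 612)" | (small) "(s, t) \<in> set [(6, 3), (27, 18), (9, 6), (8, 6),
      (30, 30), (21, 21), (18, 18), (15, 15), (12, 12)]"
    by auto
  then show ?thesis
  proof cases
    case 1
    then have uvw: "u * v * w = 4913" using area2 by auto
    have "w \<le> 17"
    proof (rule ccontr)
      assume "\<not> w \<le> 17"
      then have "18 * 18 * 18 \<le> u * v * w" using ord by (intro mult_mono) auto
      then show False using uvw by simp
    qed
    moreover have "v \<le> 70"
    proof (rule ccontr)
      assume "\<not> v \<le> 70"
      then have "71 * 71 * 1 \<le> u * v * w" using ord by (intro mult_mono) auto
      then show False using uvw by simp
    qed
    ultimately have "w \<in> {1..17}" "v \<in> {w..70}" using ord by auto
    then have "(612 - v - w) * v * w \<noteq> 4913"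
      by (rule partner_search_612[unfolded list_all_iff set_upto, rule_format])
    then show ?thesis using uvw 1 u by simp
  next
    case small
    then have "t \<le> 30" by auto
    then have "w \<in> {1..10}" "v \<in> {w..15}" using le3 ord by auto
    then have "(s, t - v - w, v, w) \<in> {(27, 9, 6, 3), (30, 24, 5, 1), (21, 14, 6, 1),
        (18, 9, 8, 1), (15, 10, 3, 2), (12, 6, 4, 2)}"
      using le3 eq by (intro bspec[OF partner_search[unfolded list_all_iff set_upto if_else_True] small,
        unfolded prod.case, rule_format])
    then have "(s, u, v, w) \<in> {(27, 9, 6, 3), (30, 24, 5, 1), (21, 14, 6, 1),
        (18, 9, 8, 1), (15, 10, 3, 2), (12, 6, 4, 2)}"
      by (simp only: u)
    then show ?thesis
      using candidates s t by (elim insertE; simp)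
  qed
qed

end

section \<open>Amicable pairs\<close>

lemma amicable_heron_triangles:
  assumes "heron_triangle H1" "heron_triangle H2" "amicable H1 H2" "perimeter H2 \<le> perimeter H1"
  shows "side_lengths H1 = {#3, 25, 26#} \<and> side_lengths H2 = {#9, 12, 15#} \<or>
    side_lengths H1 = side_lengths H2"
proof -
  obtain x y z where 1: "0 < z" "z \<le> y" "y \<le> x"
    "side_lengths H1 = {#of_int (y + z), of_int (x + z), of_int (x + y)#}"
    "perimeter H1 = of_int (2 * (x + y + z))"
    "(area H1)\<^sup>2 = of_int ((x + y + z) * x * y * z)"
    by (rule heron_triangle_tangents[OF assms(1)])
  obtain u v w where 2: "0 < w" "w \<le> v" "v \<le> u"
    "side_lengths H2 = {#of_int (v + w), of_int (u + w), of_int (u + v)#}"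
    "perimeter H2 = of_int (2 * (u + v + w))"
    "(area H2)\<^sup>2 = of_int ((u + v + w) * u * v * w)"
    by (rule heron_triangle_tangents[OF assms(2)])
  have am: "area H1 = perimeter H2" "area H2 = perimeter H1"
    using assms(3) by (auto simp: amicable_def)
  have "real_of_int ((2 * (u + v + w))\<^sup>2) = of_int ((x + y + z) * x * y * z)"
    using 1(6) unfolding am 2(5) by simp
  then have a1: "(2 * (u + v + w))\<^sup>2 = (x + y + z) * x * y * z" by (simp only: of_int_eq_iff)
  have "real_of_int ((2 * (x + y + z))\<^sup>2) = of_int ((u + v + w) * u * v * w)"
    using 2(6) unfolding am 1(5) by simp
  then have a2: "(2 * (x + y + z))\<^sup>2 = (u + v + w) * u * v * w" by (simp only: of_int_eq_iff)
  have "u + v + w \<le> x + y + z" using assms(4) unfolding 1(5) 2(5) by simp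
  then interpret amicable_tangents x y z "x + y + z" u v w "u + v + w"
    using 1(1-3) 2(1-3) a1 a2
    by unfold_locales (simp_all only: power_mult_distrib mult.assoc, simp_all)
  show ?thesis
    using solutions 1(4) 2(4) by auto
qed

lemma area_eqI:
  assumes "16 * k\<^sup>2 = perimeter T * (\<Prod>l\<in>#side_lengths T. perimeter T - 2 * l)" "0 \<le> k"
  shows "area T = k"
proof -
  have "(area T)\<^sup>2 = k\<^sup>2" using heron_mset[of T] assms(1) by simp
  then show ?thesis using area_nonneg assms(2) by simp
qed

lemma dist_2: "dist A B = sqrt ((A $ 1 - B $ 1)\<^sup>2 + (A $ 2 - B $ 2)\<^sup>2)" for A B :: "real ^ 2"
  by (simp add: dist_vec_def L2_set_def sum_2 dist_real_def)

lemma sides_3_25_26: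
  "\<exists>T. nondegenerate T \<and> side_lengths T = {#3, 25, 26#}"
proof -
  define B C :: "real ^ 2" where BC: "B = vector [3, 0]" "C = vector [-7, 24]"
  have "nondegenerate (0, B, C)"
    by (auto simp: collinear_lemma BC vec_eq_iff forall_2)
  moreover have "dist B C = sqrt (26\<^sup>2)" "dist 0 C = sqrt (25\<^sup>2)" "dist 0 B = sqrt (3\<^sup>2)"
    by (simp_all add: dist_2 BC)
  then have "side_lengths (0, B, C) = {#3, 25, 26#}" by simp
  ultimately show ?thesis by blast
qed

lemma sides_9_12_15:
  "\<exists>T. nondegenerate T \<and> side_lengths T = {#9, 12, 15#}"
proof -
  define B C :: "real ^ 2" where BC: "B = vector [9, 0]" "C = vector [0, 12]"
  have "nondegenerate (0, B, C)"
    by (auto simp: collinear_lemma BC vec_eq_iff forall_2)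
  moreover have "dist B C = sqrt (15\<^sup>2)" "dist 0 C = sqrt (12\<^sup>2)" "dist 0 B = sqrt (9\<^sup>2)"
    by (simp_all add: dist_2 BC)
  then have "side_lengths (0, B, C) = {#9, 12, 15#}" by simp
  ultimately show ?thesis by blast
qed

theorem mainTheorem1:
  shows "(\<exists>T. nondegenerate T \<and> side_lengths T = {#3, 25, 26#}) \<and>
    (\<exists>T. nondegenerate T \<and> side_lengths T = {#9, 12, 15#}) \<and>
    (\<forall>H1 H2. nondegenerate H1 \<longrightarrow> nondegenerate H2 \<longrightarrow>
       side_lengths H1 = {#3, 25, 26#} \<longrightarrow> side_lengths H2 = {#9, 12, 15#} \<longrightarrow>
       heron_triangle H1 \<and> heron_triangle H2 \<and>
       \<not> congruent_triangles H1 H2 \<and> amicable H1 H2) \<and>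
    (\<forall>H1 H2. heron_triangle H1 \<longrightarrow> heron_triangle H2 \<longrightarrow>
       \<not> congruent_triangles H1 H2 \<longrightarrow> amicable H1 H2 \<longrightarrow>
       side_lengths H1 = {#3, 25, 26#} \<and> side_lengths H2 = {#9, 12, 15#} \<or>
       side_lengths H1 = {#9, 12, 15#} \<and> side_lengths H2 = {#3, 25, 26#})"
proof (intro conjI allI impI)
  show "\<exists>T. nondegenerate T \<and> side_lengths T = {#3, 25, 26#}"
    by (rule sides_3_25_26)
  show "\<exists>T. nondegenerate T \<and> side_lengths T = {#9, 12, 15#}"
    by (rule sides_9_12_15)
next
  fix H1 H2
  assume nd: "nondegenerate H1" "nondegenerate H2"
    and sl: "side_lengths H1 = {#3, 25, 26#}" "side_lengths H2 = {#9, 12, 15#}"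
  have p: "perimeter H1 = 54" "perimeter H2 = 36" by (simp_all add: perimeter_def sl)
  have a: "area H1 = 36" "area H2 = 54" by (rule area_eqI; simp add: p sl)+
  show "heron_triangle H1" "heron_triangle H2"
    using nd by (auto simp: heron_triangle_def sl a)
  show "amicable H1 H2" by (simp add: amicable_def a p)
  show "\<not> congruent_triangles H1 H2"
    using p by (auto simp: congruent_triangles_def perimeter_def)
next
  fix H1 H2
  assume H: "heron_triangle H1" "heron_triangle H2" "\<not> congruent_triangles H1 H2" "amicable H1 H2"
  then have "amicable H2 H1" by (auto simp: amicable_def)
  then show "side_lengths H1 = {#3, 25, 26#} \<and> side_lengths H2 = {#9, 12, 15#} \<or>
       side_lengths H1 = {#9, 12, 15#} \<and> side_lengths H2 = {#3, 25, 26#}"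
    using H amicable_heron_triangles[of H1 H2] amicable_heron_triangles[of H2 H1]
    unfolding congruent_triangles_def by (metis linear)
qed

end
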